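(* Let $\mathfrak A$ be a generalized model in the narrow sense with universe $\beta X$ and interpretation $\imath$, and let $\mathfrak U=i(\mathfrak A)$ be the generalized model in the wide sense with universe $\beta X$ and interpretation $F\mapsto i(\imath(F))$, $R\mapsto i(\imath(R))$, with limits taken in the topologies described below. Then $\lim\mathfrak U$ exists and for every formula $\varphi$ and every valuation $v$ of variables in $\beta X$: $\lim\mathfrak U\models\varphi[v]$ iff $\mathfrak A\Vdash\varphi[v]$.
   Context: $\beta X$ is the set of ultrafilters on $X$, $X\subseteq\beta X$ via principal ultrafilters, standard compact Hausdorff topology; $(\forall^{\mathfrak u}x)\varphi$ means $\{x:\varphi\}\in\mathfrak u$. For $f:X^n\to X$, $\tilde f(\mathfrak u_1,\dots,\mathfrak u_n)=\{A:(\forall^{\mathfrak u_1}x_1)\cdots(\forall^{\mathfrak u_n}x_n)f(x_1,\dots,x_n)\in A\}$; for $Q\subseteq X^n$, $\tilde Q=\{(\mathfrak u_i):(\forall^{\mathfrak u_1}x_1)\cdots(\forall^{\mathfrak u_n}x_n)(x_1,\dots,x_n)\in Q\}$. Narrow sense: interpretation $\imath$ with $\imath(F)\in\beta(X^{X^n})$, $\imath(R)\in\beta\,\mathcal P(X^n)$ for $n$-ary symbols; $\widetilde{\mathrm{app}}(\mathfrak u_1,\dots,\mathfrak u_n,\mathfrak f)=\{A:(\forall^{\mathfrak u_1}x_1)\cdots(\forall^{\mathfrak u_n}x_n)(\forall^{\mathfrak f}f)f(x_1,\dots,x_n)\in A\}$, $\widetilde{\mathrm{in}}(\mathfrak u_1,\dots,\mathfrak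 u_n,\mathfrak r)$ iff $(\forall^{\mathfrak u_1}x_1)\cdots(\forall^{\mathfrak u_n}x_n)(\forall^{\mathfrak r}Q)(x_1,\dots,x_n)\in Q$; for a valuation $v$ into $\beta X$, $v_\imath(F(t_1,\dots,t_n))=\widetilde{\mathrm{app}}(v_\imath(t_1),\dots,v_\imath(t_n),\imath(F))$; $\mathfrak A\Vdash t_1=t_2[v]$ iff $v_\imath(t_1)=v_\imath(t_2)$, $\mathfrak A\Vdash R(t_1,\dots,t_n)[v]$ iff $\widetilde{\mathrm{in}}(v_\imath(t_1),\dots,v_\imath(t_n),\imath(R))$, other connectives and quantifiers (over $\beta X$) as usual. Wide sense: a generalized model with universe a set $W$ assigns $\mathfrak f\in\beta(W^{W^n})$ to $n$-ary functional and $\mathfrak r\in\beta\,\mathcal P(W^n)$ to $n$-ary predicate symbols; given topologies on the relevant sets, an ultrafilter has limit $p$ if it converges to $p$ and to no other point; if all interpreting ultrafilters have limits, $\lim\mathfrak U$ is the ordinary model on $W$ interpreting each symbol by the limit. The map $i$: for $\mathfrak f\in\beta(X^{X^n})$, $i(\mathfrak f)=\{B\subseteq(\beta X)^{(\beta X)^n}:\{f:\tilde f\in B\}\in\mathfrak f\}$; for $\mathfrak r\in\beta\,\mathcal P(X^n)$, $i(\mathfrak r)=\{B\subseteq\mathcal P((\beta X)^n):\{Q:\tilde Q\in B\}\in\mathfrak r\}$. Topologies: $i(\mathfrak f)$ is concentrated on the set $\mathrm{RC}_n$ of maps $(\beta X)^n\to\beta X$ right continuous w.r.t. $X$ (continuous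 in the $i$-th argument whenever the first $i-1$ arguments lie in $X$), and its limit is taken in $\mathrm{RC}_n$ with the topology of pointwise convergence on $X^n$ (subbase $\{g:g(a)\in U\}$, $a\in X^n$, $U$ open); $i(\mathfrak r)$ is concentrated on the set of subsets of $(\beta X)^n$ right clopen w.r.t. $X$ (sections in the $i$-th coordinate clopen whenever the first $i-1$ coordinates lie in $X$), and its limit is taken there with the topology of pointwise convergence on $X^n$ of characteristic functions into discrete $\{0,1\}$. *)

theory Defs
  imports "HOL-Analysis.Analysis"
begin

definition ultrafilter :: "'a filter \<Rightarrow> bool" where
  "ultrafilter F \<longleftrightarrow> F \<noteq> bot \<and> (\<forall>P. eventually P F \<or> eventually (\<lambda>x. \<not> P x) F)"

lemma ultrafilter_principal: "ultrafilter (principal {x})"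
  by (auto simp: ultrafilter_def eventually_principal principal_eq_bot_iff)

typedef 'a beta = "{F :: 'a filter. ultrafilter F}"
  by (rule exI, rule CollectI, rule ultrafilter_principal)

text \<open>The quantifier "for u-almost all x" is \<open>\<forall>\<^sub>F x in Rep_beta u\<close>.
  For a proper subset S of a type, an ultrafilter on S is represented by the ultrafilter on the
  whole type that it generates, i.e. by an ultrafilter on the type containing S.\<close>

definition concentrated_on :: "'a beta \<Rightarrow> 'a set \<Rightarrow> bool" where
  "concentrated_on u S \<longleftrightarrow> (\<forall>\<^sub>F x in Rep_beta u. x \<in> S)"

definition pr :: "'a \<Rightarrow> 'a beta" where
  "pr x = Abs_beta (principal {x})"

text \<open>The ultrafilter whose members are exactly the sets in a given family; meaningful only if
  the family is an ultrafilter (see \<open>eventually_beta_of_sets\<close>).\<close>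

definition beta_of_sets :: "'a set set \<Rightarrow> 'a beta" where
  "beta_of_sets \<U> = Abs_beta (Abs_filter (\<lambda>P. {x. P x} \<in> \<U>))"

instantiation beta :: (type) topological_space
begin

definition open_beta :: "'a beta set \<Rightarrow> bool" where
  "open_beta = generate_topology (range (\<lambda>A. {u. \<forall>\<^sub>F x in Rep_beta u. x \<in> A}))"

instance
  by standard
    (auto simp: open_beta_def intro: generate_topology.intros generate_topology.UNIV)

end

text \<open>The iterated quantifier "for u1-almost all x1, ..., for un-almost all xn, P [x1, ..., xn]",
  the first ultrafilter being the outermost one.\<close>

primrec forall_ultra :: "'a beta list \<Rightarrow> ('a list \<Rightarrow> bool) \<Rightarrow> bool" where
  "forall_ultra [] P \<longleftrightarrow> P []"
| "forall_ultra (u # us) P \<longleftrightarrow> (\<forall>\<^sub>F x in Rep_beta u. forall_ultra us (\<lambda>xs. P (x # xs)))"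

text \<open>The n-th power of a type consists of the lists of length n; n-ary operations are
  extensional (\<open>undefined\<close> on lists of any other length), so that there is exactly one
  representative for each map.\<close>

definition tuples :: "nat \<Rightarrow> 'a list set" where
  "tuples n = {xs. length xs = n}"

definition ops :: "nat \<Rightarrow> ('a list \<Rightarrow> 'a) set" where
  "ops n = tuples n \<rightarrow>\<^sub>E UNIV"

definition rels :: "nat \<Rightarrow> 'a list set set" where
  "rels n = Pow (tuples n)"

definition ext_op :: "nat \<Rightarrow> ('a list \<Rightarrow> 'a) \<Rightarrow> ('a beta list \<Rightarrow> 'a beta)" where
  "ext_op n f = (\<lambda>us \<in> tuples n. beta_of_sets {A. forall_ultra us (\<lambda>xs. f xs \<in> A)})"

definition ext_rel :: "nat \<Rightarrow> 'a list set \<Rightarrow> 'a beta list set" where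
  "ext_rel n Q = {us \<in> tuples n. forall_ultra us (\<lambda>xs. xs \<in> Q)}"

definition app_ext :: "'a beta list \<Rightarrow> ('a list \<Rightarrow> 'a) beta \<Rightarrow> 'a beta" where
  "app_ext us \<ff> =
     beta_of_sets {A. forall_ultra us (\<lambda>xs. \<forall>\<^sub>F f in Rep_beta \<ff>. f xs \<in> A)}"

definition in_ext :: "'a beta list \<Rightarrow> 'a list set beta \<Rightarrow> bool" where
  "in_ext us \<rr> \<longleftrightarrow> forall_ultra us (\<lambda>xs. \<forall>\<^sub>F Q in Rep_beta \<rr>. xs \<in> Q)"

definition i_op :: "nat \<Rightarrow> ('a list \<Rightarrow> 'a) beta \<Rightarrow> ('a beta list \<Rightarrow> 'a beta) beta" where
  "i_op n \<ff> = beta_of_sets {B. \<forall>\<^sub>F f in Rep_beta \<ff>. ext_op n f \<in> B}"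

definition i_rel :: "nat \<Rightarrow> 'a list set beta \<Rightarrow> 'a beta list set beta" where
  "i_rel n \<rr> = beta_of_sets {B. \<forall>\<^sub>F Q in Rep_beta \<rr>. ext_rel n Q \<in> B}"

text \<open>A language consists of the types \<open>'f\<close> and \<open>'p\<close> of functional and predicate symbols
  together with arity functions \<open>fa\<close> and \<open>pa\<close>; \<open>'v\<close> is the type of variables.\<close>

datatype ('f, 'v) tm = Var 'v | Fn 'f "('f, 'v) tm list"

datatype ('f, 'p, 'v) fm =
    Eq "('f, 'v) tm" "('f, 'v) tm"
  | Rel 'p "('f, 'v) tm list"
  | Neg "('f, 'p, 'v) fm"
  | Conj "('f, 'p, 'v) fm" "('f, 'p, 'v) fm"
  | Disj "('f, 'p, 'v) fm" "('f, 'p, 'v) fm"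
  | Impl "('f, 'p, 'v) fm" "('f, 'p, 'v) fm"
  | All 'v "('f, 'p, 'v) fm"
  | Ex 'v "('f, 'p, 'v) fm"

fun wf_tm :: "('f \<Rightarrow> nat) \<Rightarrow> ('f, 'v) tm \<Rightarrow> bool" where
  "wf_tm fa (Var x) \<longleftrightarrow> True"
| "wf_tm fa (Fn F ts) \<longleftrightarrow> length ts = fa F \<and> (\<forall>t \<in> set ts. wf_tm fa t)"

primrec wf_fm :: "('f \<Rightarrow> nat) \<Rightarrow> ('p \<Rightarrow> nat) \<Rightarrow> ('f, 'p, 'v) fm \<Rightarrow> bool" where
  "wf_fm fa pa (Eq s t) \<longleftrightarrow> wf_tm fa s \<and> wf_tm fa t"
| "wf_fm fa pa (Rel R ts) \<longleftrightarrow> length ts = pa R \<and> (\<forall>t \<in> set ts. wf_tm fa t)"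
| "wf_fm fa pa (Neg \<phi>) \<longleftrightarrow> wf_fm fa pa \<phi>"
| "wf_fm fa pa (Conj \<phi> \<psi>) \<longleftrightarrow> wf_fm fa pa \<phi> \<and> wf_fm fa pa \<psi>"
| "wf_fm fa pa (Disj \<phi> \<psi>) \<longleftrightarrow> wf_fm fa pa \<phi> \<and> wf_fm fa pa \<psi>"
| "wf_fm fa pa (Impl \<phi> \<psi>) \<longleftrightarrow> wf_fm fa pa \<phi> \<and> wf_fm fa pa \<psi>"
| "wf_fm fa pa (All x \<phi>) \<longleftrightarrow> wf_fm fa pa \<phi>"
| "wf_fm fa pa (Ex x \<phi>) \<longleftrightarrow> wf_fm fa pa \<phi>"

record ('f, 'p, 'w) model =
  op_of :: "'f \<Rightarrow> 'w list \<Rightarrow> 'w"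
  rel_of :: "'p \<Rightarrow> 'w list set"

fun eval :: "('f, 'p, 'w) model \<Rightarrow> ('v \<Rightarrow> 'w) \<Rightarrow> ('f, 'v) tm \<Rightarrow> 'w" where
  "eval M v (Var x) = v x"
| "eval M v (Fn F ts) = op_of M F (map (eval M v) ts)"

primrec sat :: "('f, 'p, 'w) model \<Rightarrow> ('v \<Rightarrow> 'w) \<Rightarrow> ('f, 'p, 'v) fm \<Rightarrow> bool" where
  "sat M v (Eq s t) \<longleftrightarrow> eval M v s = eval M v t"
| "sat M v (Rel R ts) \<longleftrightarrow> map (eval M v) ts \<in> rel_of M R"
| "sat M v (Neg \<phi>) \<longleftrightarrow> \<not> sat M v \<phi>"
| "sat M v (Conj \<phi> \<psi>) \<longleftrightarrow> sat M v \<phi> \<and> sat M v \<psi>"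
| "sat M v (Disj \<phi> \<psi>) \<longleftrightarrow> sat M v \<phi> \<or> sat M v \<psi>"
| "sat M v (Impl \<phi> \<psi>) \<longleftrightarrow> (sat M v \<phi> \<longrightarrow> sat M v \<psi>)"
| "sat M v (All x \<phi>) \<longleftrightarrow> (\<forall>a. sat M (v(x := a)) \<phi>)"
| "sat M v (Ex x \<phi>) \<longleftrightarrow> (\<exists>a. sat M (v(x := a)) \<phi>)"

text \<open>An assignment of ultrafilters on n-ary operations and relations over \<open>'w\<close>. It is read
  in two ways: in the narrow sense it is a generalized model with universe \<open>'w beta\<close>, with
  satisfaction \<open>nsat\<close>; in the wide sense it is one with universe \<open>'w\<close>, which may have a limit.\<close>

record ('f, 'p, 'w) gmodel =
  gop_of :: "'f \<Rightarrow> ('w list \<Rightarrow> 'w) beta"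
  grel_of :: "'p \<Rightarrow> 'w list set beta"

definition is_gmodel :: "('f \<Rightarrow> nat) \<Rightarrow> ('p \<Rightarrow> nat) \<Rightarrow> ('f, 'p, 'w) gmodel \<Rightarrow> bool" where
  "is_gmodel fa pa \<AA> \<longleftrightarrow>
     (\<forall>F. concentrated_on (gop_of \<AA> F) (ops (fa F))) \<and>
     (\<forall>R. concentrated_on (grel_of \<AA> R) (rels (pa R)))"

fun neval :: "('f, 'p, 'a) gmodel \<Rightarrow> ('v \<Rightarrow> 'a beta) \<Rightarrow> ('f, 'v) tm \<Rightarrow> 'a beta" where
  "neval \<AA> v (Var x) = v x"
| "neval \<AA> v (Fn F ts) = app_ext (map (neval \<AA> v) ts) (gop_of \<AA> F)"

primrec nsat :: "('f, 'p, 'a) gmodel \<Rightarrow> ('v \<Rightarrow> 'a beta) \<Rightarrow> ('f, 'p, 'v) fm \<Rightarrow> bool" where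
  "nsat \<AA> v (Eq s t) \<longleftrightarrow> neval \<AA> v s = neval \<AA> v t"
| "nsat \<AA> v (Rel R ts) \<longleftrightarrow> in_ext (map (neval \<AA> v) ts) (grel_of \<AA> R)"
| "nsat \<AA> v (Neg \<phi>) \<longleftrightarrow> \<not> nsat \<AA> v \<phi>"
| "nsat \<AA> v (Conj \<phi> \<psi>) \<longleftrightarrow> nsat \<AA> v \<phi> \<and> nsat \<AA> v \<psi>"
| "nsat \<AA> v (Disj \<phi> \<psi>) \<longleftrightarrow> nsat \<AA> v \<phi> \<or> nsat \<AA> v \<psi>"
| "nsat \<AA> v (Impl \<phi> \<psi>) \<longleftrightarrow> (nsat \<AA> v \<phi> \<longrightarrow> nsat \<AA> v \<psi>)"
| "nsat \<AA> v (All x \<phi>) \<longleftrightarrow> (\<forall>a. nsat \<AA> (v(x := a)) \<phi>)"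
| "nsat \<AA> v (Ex x \<phi>) \<longleftrightarrow> (\<exists>a. nsat \<AA> (v(x := a)) \<phi>)"

definition i_model ::
  "('f \<Rightarrow> nat) \<Rightarrow> ('p \<Rightarrow> nat) \<Rightarrow> ('f, 'p, 'a) gmodel \<Rightarrow> ('f, 'p, 'a beta) gmodel" where
  "i_model fa pa \<AA> =
     \<lparr>gop_of = (\<lambda>F. i_op (fa F) (gop_of \<AA> F)), grel_of = (\<lambda>R. i_rel (pa R) (grel_of \<AA> R))\<rparr>"

text \<open>In the following, \<open>S n\<close> and \<open>T n\<close> are topologies on sets of n-ary operations and
  relations. Since \<open>limitin\<close> demands that the limit lie in \<open>topspace\<close> and \<open>topspace\<close> is open, an
  ultrafilter with a limit is concentrated on the underlying set of the topology.\<close>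

definition has_limit :: "'x topology \<Rightarrow> 'x beta \<Rightarrow> 'x \<Rightarrow> bool" where
  "has_limit T u p \<longleftrightarrow>
     limitin T (\<lambda>x. x) p (Rep_beta u) \<and> (\<forall>q. limitin T (\<lambda>x. x) q (Rep_beta u) \<longrightarrow> q = p)"

definition lim_exists ::
  "(nat \<Rightarrow> ('w list \<Rightarrow> 'w) topology) \<Rightarrow> (nat \<Rightarrow> 'w list set topology) \<Rightarrow>
   ('f \<Rightarrow> nat) \<Rightarrow> ('p \<Rightarrow> nat) \<Rightarrow> ('f, 'p, 'w) gmodel \<Rightarrow> bool" where
  "lim_exists S T fa pa \<UU> \<longleftrightarrow>
     (\<forall>F. \<exists>f. has_limit (S (fa F)) (gop_of \<UU> F) f) \<and>
     (\<forall>R. \<exists>Q. has_limit (T (pa R)) (grel_of \<UU> R) Q)"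

definition lim_model ::
  "(nat \<Rightarrow> ('w list \<Rightarrow> 'w) topology) \<Rightarrow> (nat \<Rightarrow> 'w list set topology) \<Rightarrow>
   ('f \<Rightarrow> nat) \<Rightarrow> ('p \<Rightarrow> nat) \<Rightarrow> ('f, 'p, 'w) gmodel \<Rightarrow> ('f, 'p, 'w) model" where
  "lim_model S T fa pa \<UU> =
     \<lparr>op_of = (\<lambda>F. THE f. has_limit (S (fa F)) (gop_of \<UU> F) f),
      rel_of = (\<lambda>R. THE Q. has_limit (T (pa R)) (grel_of \<UU> R) Q)\<rparr>"

definition RC :: "nat \<Rightarrow> ('a beta list \<Rightarrow> 'a beta) set" where
  "RC n = {g \<in> ops n. \<forall>as us. length as + 1 + length us = n \<longrightarrow>
             continuous_on UNIV (\<lambda>u. g (map pr as @ u # us))}"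

definition RClop :: "nat \<Rightarrow> 'a beta list set set" where
  "RClop n = {Q \<in> rels n. \<forall>as us. length as + 1 + length us = n \<longrightarrow>
                open {u. map pr as @ u # us \<in> Q} \<and> closed {u. map pr as @ u # us \<in> Q}}"

definition RC_topology :: "nat \<Rightarrow> ('a beta list \<Rightarrow> 'a beta) topology" where
  "RC_topology n =
     topology_generated_by {{g \<in> RC n. g (map pr a) \<in> U} | a U. a \<in> tuples n \<and> open U}"

text \<open>Every \<open>V :: bool set\<close> is open in the discrete two-point space.\<close>

definition RClop_topology :: "nat \<Rightarrow> 'a beta list set topology" where
  "RClop_topology n =
     topology_generated_by {{Q \<in> RClop n. (map pr a \<in> Q) \<in> V} | a V. a \<in> tuples n}"

lemma ultrafilter_Rep_beta: "ultrafilter (Rep_beta u)"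
  using Rep_beta by blast

lemma eventually_not_Rep_beta:
  "(\<forall>\<^sub>F x in Rep_beta u. \<not> P x) \<longleftrightarrow> \<not> (\<forall>\<^sub>F x in Rep_beta u. P x)"
proof -
  have "False" if "\<forall>\<^sub>F x in Rep_beta u. \<not> P x" "\<forall>\<^sub>F x in Rep_beta u. P x"
  proof -
    have "\<forall>\<^sub>F x in Rep_beta u. False"
      using eventually_conj[OF that] by simp
    then show False
      using ultrafilter_Rep_beta[of u] by (simp add: ultrafilter_def trivial_limit_def)
  qed
  then show ?thesis
    using ultrafilter_Rep_beta[of u] by (auto simp: ultrafilter_def)
qed

lemma Rep_beta_pr: "Rep_beta (pr x) = principal {x}"
  by (simp add: pr_def Abs_beta_inverse ultrafilter_principal)

lemma eventually_beta_of_sets: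
  assumes "\<And>A B. A \<in> \<U> \<Longrightarrow> B \<in> \<U> \<Longrightarrow> A \<inter> B \<in> \<U>"
    and "\<And>A B. A \<in> \<U> \<Longrightarrow> A \<subseteq> B \<Longrightarrow> B \<in> \<U>"
    and "\<And>A. - A \<in> \<U> \<longleftrightarrow> A \<notin> \<U>"
  shows "(\<forall>\<^sub>F x in Rep_beta (beta_of_sets \<U>). P x) \<longleftrightarrow> {x. P x} \<in> \<U>"
proof -
  have univ: "UNIV \<in> \<U>"
    using assms(2,3) by blast
  have "is_filter (\<lambda>P. {x. P x} \<in> \<U>)"
  proof
    show "{x. True} \<in> \<U>" using univ by simp
    show "{x. P x \<and> Q x} \<in> \<U>" if "{x. P x} \<in> \<U>" "{x. Q x} \<in> \<U>" for P Q
      using assms(1)[OF that] by (simp add: Collect_conj_eq)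
    show "{x. Q x} \<in> \<U>" if "\<forall>x. P x \<longrightarrow> Q x" "{x. P x} \<in> \<U>" for P Q
      using assms(2)[OF that(2)] that(1) by blast
  qed
  then have ev: "eventually P (Abs_filter (\<lambda>P. {x. P x} \<in> \<U>)) \<longleftrightarrow> {x. P x} \<in> \<U>" for P
    by (rule eventually_Abs_filter)
  have "{} \<notin> \<U>"
    using assms(3)[of UNIV] univ by simp
  moreover have "{x. P x} \<in> \<U> \<or> {x. \<not> P x} \<in> \<U>" for P
    using assms(3)[of "{x. P x}"] by (simp add: Collect_neg_eq)
  ultimately have "ultrafilter (Abs_filter (\<lambda>P. {x. P x} \<in> \<U>))"
    by (simp add: ultrafilter_def trivial_limit_def ev)
  then show ?thesis
    by (simp add: beta_of_sets_def Abs_beta_inverse ev)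
qed

lemma forall_ultra_mono:
  assumes "forall_ultra us P" "\<And>xs. P xs \<Longrightarrow> Q xs"
  shows "forall_ultra us Q"
  using assms
proof (induction us arbitrary: P Q)
  case (Cons u us)
  show ?case
    using Cons.prems(1) by (auto elim!: eventually_mono intro: Cons.IH Cons.prems(2))
qed simp

lemma forall_ultra_conj:
  "forall_ultra us (\<lambda>xs. P xs \<and> Q xs) \<longleftrightarrow> forall_ultra us P \<and> forall_ultra us Q"
  by (induction us arbitrary: P Q) (simp_all add: eventually_conj_iff)

lemma forall_ultra_not:
  "forall_ultra us (\<lambda>xs. \<not> P xs) \<longleftrightarrow> \<not> forall_ultra us P"
  by (induction us arbitrary: P) (simp_all add: eventually_not_Rep_beta)

lemma eventually_ext_op:
  assumes "length us = n"
  shows "(\<forall>\<^sub>F x in Rep_beta (ext_op n f us). P x) \<longleftrightarrow> forall_ultra us (\<lambda>xs. P (f xs))"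
  using assms unfolding ext_op_def
  by (simp add: tuples_def, subst eventually_beta_of_sets)
    (auto simp: forall_ultra_conj forall_ultra_not elim: forall_ultra_mono)

lemma eventually_app_ext:
  "(\<forall>\<^sub>F x in Rep_beta (app_ext us \<ff>). P x) \<longleftrightarrow>
     forall_ultra us (\<lambda>xs. \<forall>\<^sub>F f in Rep_beta \<ff>. P (f xs))"
  unfolding app_ext_def
  by (subst eventually_beta_of_sets)
    (auto simp: forall_ultra_conj forall_ultra_not eventually_conj_iff eventually_not_Rep_beta
      elim!: forall_ultra_mono eventually_mono)

lemma eventually_i_op:
  "(\<forall>\<^sub>F g in Rep_beta (i_op n \<ff>). P g) \<longleftrightarrow> (\<forall>\<^sub>F f in Rep_beta \<ff>. P (ext_op n f))"
  unfolding i_op_def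
  by (subst eventually_beta_of_sets)
    (auto simp: eventually_conj_iff eventually_not_Rep_beta elim!: eventually_mono)

lemma eventually_i_rel:
  "(\<forall>\<^sub>F g in Rep_beta (i_rel n \<rr>). P g) \<longleftrightarrow> (\<forall>\<^sub>F Q in Rep_beta \<rr>. P (ext_rel n Q))"
  unfolding i_rel_def
  by (subst eventually_beta_of_sets)
    (auto simp: eventually_conj_iff eventually_not_Rep_beta elim!: eventually_mono)

lemma is_gmodel_i_model: "is_gmodel fa pa (i_model fa pa \<AA>)"
  by (simp add: is_gmodel_def i_model_def concentrated_on_def eventually_i_op eventually_i_rel
      ext_op_def ext_rel_def ops_def rels_def)

lemma topspace_RC_topology: "topspace (RC_topology n) = RC n"
proof -
  obtain a :: "'a list" where a: "a \<in> tuples n"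
    using Ex_list_of_length by (auto simp: tuples_def)
  have "RC n = {g \<in> RC n. g (map pr a) \<in> UNIV}" by simp
  with a show ?thesis
    unfolding RC_topology_def topology_generated_by_topspace by blast
qed

lemma topspace_RClop_topology: "topspace (RClop_topology n) = RClop n"
proof -
  obtain a :: "'a list" where a: "a \<in> tuples n"
    using Ex_list_of_length by (auto simp: tuples_def)
  have "RClop n = {Q \<in> RClop n. (map pr a \<in> Q) \<in> UNIV}" by simp
  with a show ?thesis
    unfolding RClop_topology_def topology_generated_by_topspace by blast
qed

end

(* The limit of i(f) is us |-> app_ext us f, and the limit of i(r) is {us. in_ext us r}. A clopen set
   of ultrafilters contains u iff it contains pr x for u-almost all x; peeling off one argument at a
   time, a right continuous operation (right clopen relation) is therefore determined by its values
   on principal tuples, and these values are prescribed for every limit. *)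

theory Submission imports Defs begin

section \<open>Topology of the space of ultrafilters\<close>

lemma beta_eqI:
  assumes "\<And>P. (\<forall>\<^sub>F x in Rep_beta u. P x) \<longleftrightarrow> (\<forall>\<^sub>F x in Rep_beta w. P x)"
  shows "u = w"
  using assms by (simp add: Rep_beta_inject[symmetric] filter_eq_iff)

lemma eventually_pr [simp]: "(\<forall>\<^sub>F x in Rep_beta (pr a). P x) \<longleftrightarrow> P a"
  by (simp add: Rep_beta_pr eventually_principal)

lemma open_beta_basic: "open {u. \<forall>\<^sub>F x in Rep_beta u. P x}"
  unfolding open_beta_def
  by (intro generate_topology.Basis range_eqI[where x = "{x. P x}"]) simp

lemma closed_beta_basic: "closed {u. \<forall>\<^sub>F x in Rep_beta u. P x}"
proof -
  have "- {u. \<forall>\<^sub>F x in Rep_beta u. P x} = {u. \<forall>\<^sub>F x in Rep_beta u. \<not> P x}"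
    by (auto simp: eventually_not_Rep_beta)
  then show ?thesis
    using open_beta_basic[of "\<lambda>x. \<not> P x"] by (simp add: closed_def)
qed

text \<open>A set \<open>A \<inter> B\<close> is large for \<open>u\<close> exactly when
  \<open>A\<close> and \<open>B\<close> both are, so the generating sets are closed under binary
  intersection and already form a base.\<close>

lemma open_beta_basis:
  assumes "open C" "u \<in> C"
  obtains A where "\<forall>\<^sub>F x in Rep_beta u. x \<in> A" "{w. \<forall>\<^sub>F x in Rep_beta w. x \<in> A} \<subseteq> C"
proof -
  have "\<exists>A. (\<forall>\<^sub>F x in Rep_beta u. x \<in> A) \<and> {w. \<forall>\<^sub>F x in Rep_beta w. x \<in> A} \<subseteq> C"
    using assms unfolding open_beta_def
  proof (induction C rule: generate_topology.induct)
    case UNIV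
    show ?case by (rule exI[of _ UNIV]) simp
  next
    case (Int C D)
    then obtain A B where
      "(\<forall>\<^sub>F x in Rep_beta u. x \<in> A) \<and> {w. \<forall>\<^sub>F x in Rep_beta w. x \<in> A} \<subseteq> C"
      "(\<forall>\<^sub>F x in Rep_beta u. x \<in> B) \<and> {w. \<forall>\<^sub>F x in Rep_beta w. x \<in> B} \<subseteq> D"
      by blast
    then show ?case
      by (intro exI[of _ "A \<inter> B"]) (auto simp: eventually_conj_iff)
  next
    case (UN K)
    then obtain C where C: "C \<in> K" "u \<in> C" by blast
    with UN.IH obtain A where
      "(\<forall>\<^sub>F x in Rep_beta u. x \<in> A) \<and> {w. \<forall>\<^sub>F x in Rep_beta w. x \<in> A} \<subseteq> C"
      by blast
    with C show ?case by blast
  qed auto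
  with that show thesis by blast
qed

text \<open>A basic neighbourhood of \<open>u\<close> given by \<open>A\<close> contains
  \<open>pr x\<close> for every \<open>x \<in> A\<close>, and \<open>u\<close>-almost all
  \<open>x\<close> lie in \<open>A\<close>. In other words, the principal ultrafilters converge to
  \<open>u\<close> along \<open>u\<close>.\<close>

lemma open_beta_imp_eventually_pr:
  assumes "open C" "u \<in> C"
  shows "\<forall>\<^sub>F x in Rep_beta u. pr x \<in> C"
proof -
  obtain A where A: "\<forall>\<^sub>F x in Rep_beta u. x \<in> A" "{w. \<forall>\<^sub>F x in Rep_beta w. x \<in> A} \<subseteq> C"
    using open_beta_basis[OF assms] .
  then have "pr x \<in> C" if "x \<in> A" for x using that by auto
  with A(1) show ?thesis by (auto elim: eventually_mono)
qed

text \<open>The previous fact applied to \<open>C\<close> gives one direction; applied to the open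
  set \<open>- C\<close> it gives the other, because \<open>u\<close> decides every
  predicate.\<close>

lemma clopen_beta_iff_eventually_pr:
  assumes "open C" "closed C"
  shows "u \<in> C \<longleftrightarrow> (\<forall>\<^sub>F x in Rep_beta u. pr x \<in> C)"
  using open_beta_imp_eventually_pr[of C u] open_beta_imp_eventually_pr[of "- C" u] assms
  by (auto simp: open_Compl eventually_not_Rep_beta)

lemma continuous_on_UNIV_betaI:
  fixes h :: "'x::topological_space \<Rightarrow> 'a beta"
  assumes "\<And>P. open {u. \<forall>\<^sub>F x in Rep_beta (h u). P x}"
  shows "continuous_on UNIV h"
proof -
  have "open (h -` C)" if "open C" for C
    using that unfolding open_beta_def
  proof (induction C rule: generate_topology.induct)
    case (Int C D)
    then show ?case by (simp add: open_Int)
  next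
    case (UN K)
    then show ?case by (auto simp: vimage_Union)
  next
    case (Basis C)
    then obtain A where "C = {u. \<forall>\<^sub>F x in Rep_beta u. x \<in> A}" by blast
    then show ?case using assms[of "\<lambda>x. x \<in> A"] by (simp add: vimage_def)
  qed simp
  then show ?thesis by (simp add: continuous_on_open_vimage)
qed

section \<open>Iterated quantifiers and clopen sections\<close>

lemma forall_ultra_map_pr_append:
  "forall_ultra (map pr as @ us) P \<longleftrightarrow> forall_ultra us (\<lambda>xs. P (as @ xs))"
  by (induction as arbitrary: P) simp_all

lemma forall_ultra_map_pr [simp]: "forall_ultra (map pr as) P \<longleftrightarrow> P as"
  using forall_ultra_map_pr_append[of as "[]" P] by simp

text \<open>Needed because convergence prescribes the values of a limit only at principal tuples of
  the correct length.\<close>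

lemma forall_ultra_cong_length:
  assumes "\<And>xs. length xs = length us \<Longrightarrow> P xs \<longleftrightarrow> Q xs"
  shows "forall_ultra us P \<longleftrightarrow> forall_ultra us Q"
  using assms
proof (induction us arbitrary: P Q)
  case (Cons u us)
  have "forall_ultra us (\<lambda>xs. P (x # xs)) \<longleftrightarrow> forall_ultra us (\<lambda>xs. Q (x # xs))" for x
    by (rule Cons.IH) (simp add: Cons.prems)
  then show ?case by simp
qed simp

text \<open>Phrased for a predicate \<open>R\<close> to serve two purposes: \<open>R us\<close> is
  membership of \<open>us\<close> in a right clopen relation, or the statement that \<open>P\<close>
  holds almost everywhere for the ultrafilter \<open>g us\<close> with \<open>g\<close> right
  continuous.\<close>

lemma forall_ultra_if_clopen_sections:
  assumes "\<And>as us. length as + 1 + length us = n \<Longrightarrow>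
      open {u. R (map pr as @ u # us)} \<and> closed {u. R (map pr as @ u # us)}"
    and "length us = n"
  shows "R us \<longleftrightarrow> forall_ultra us (\<lambda>xs. R (map pr xs))"
proof -
  \<comment> \<open>The prefix \<open>as\<close> collects the arguments already replaced by points
    and has to vary in the induction: sections are known to be clopen only behind a principal
    prefix.\<close>
  have "R (map pr as @ ws) \<longleftrightarrow> forall_ultra ws (\<lambda>xs. R (map pr (as @ xs)))"
    if "length as + length ws = n" for as ws
    using that
  proof (induction ws arbitrary: as)
    case (Cons w ws)
    have "R (map pr as @ w # ws) \<longleftrightarrow> w \<in> {u. R (map pr as @ u # ws)}" by simp
    also have "\<dots> \<longleftrightarrow> (\<forall>\<^sub>F x in Rep_beta w. pr x \<in> {u. R (map pr as @ u # ws)})"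
      using assms(1)[of as ws] Cons.prems by (intro clopen_beta_iff_eventually_pr) auto
    also have "\<dots> \<longleftrightarrow> (\<forall>\<^sub>F x in Rep_beta w. R (map pr (as @ [x]) @ ws))" by simp
    also have "\<dots> \<longleftrightarrow>
        (\<forall>\<^sub>F x in Rep_beta w. forall_ultra ws (\<lambda>xs. R (map pr ((as @ [x]) @ xs))))"
      using Cons.prems by (subst Cons.IH) auto
    finally show ?case by simp
  qed simp
  from this[of "[]" us] assms(2) show ?thesis by simp
qed

section \<open>Convergence tested on a subbase\<close>

lemma limitin_topology_generated_by:
  "limitin (topology_generated_by S) f p F \<longleftrightarrow>
     p \<in> topspace (topology_generated_by S) \<and>
     (\<forall>V\<in>S. p \<in> V \<longrightarrow> (\<forall>\<^sub>F x in F. f x \<in> V))" (is "_ \<longleftrightarrow> ?R")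
proof
  assume "limitin (topology_generated_by S) f p F"
  then show ?R
    by (auto simp: limitin_def intro: topology_generated_by_Basis)
next
  assume R: ?R
  \<comment> \<open>The sets satisfying this implication include the subbase and are closed under
    binary intersections and arbitrary unions.\<close>
  have "\<forall>\<^sub>F x in F. f x \<in> U" if "generate_topology_on S U" "p \<in> U" for U
    using that
  proof (induction U rule: generate_topology_on.induct)
    case (Int a b)
    then show ?case by (simp add: eventually_conj_iff)
  next
    case (UN K)
    then obtain k where "k \<in> K" "p \<in> k" by blast
    with UN.IH show ?case by (blast intro: eventually_mono)
  qed (use R in auto)
  with R show "limitin (topology_generated_by S) f p F"
    by (auto simp: limitin_def openin_topology_generated_by_iff)
qed

lemma ball_Collect2:
  "(\<forall>V\<in>{h a b | a b. P a b}. R V) \<longleftrightarrow> (\<forall>a b. P a b \<longrightarrow> R (h a b))"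
  by blast

lemma limitin_RC_topology:
  "limitin (RC_topology n) f g F \<longleftrightarrow> g \<in> RC n \<and>
     (\<forall>a\<in>tuples n. \<forall>U. open U \<longrightarrow> g (map pr a) \<in> U \<longrightarrow>
        (\<forall>\<^sub>F x in F. f x \<in> RC n \<and> f x (map pr a) \<in> U))"
proof -
  have "limitin (RC_topology n) f g F \<longleftrightarrow> g \<in> topspace (RC_topology n) \<and>
      (\<forall>V\<in>{{g \<in> RC n. g (map pr a) \<in> U} | a U. a \<in> tuples n \<and> open U}. g \<in> V \<longrightarrow> (\<forall>\<^sub>F x in F. f x \<in> V))"
    by (simp only: RC_topology_def limitin_topology_generated_by)
  then show ?thesis
    by (simp only: topspace_RC_topology ball_Collect2) auto
qed

lemma limitin_RClop_topology:
  "limitin (RClop_topology n) f Q F \<longleftrightarrow> Q \<in> RClop n \<and>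
     (\<forall>a\<in>tuples n. \<forall>V. (map pr a \<in> Q) \<in> V \<longrightarrow>
        (\<forall>\<^sub>F x in F. f x \<in> RClop n \<and> (map pr a \<in> f x) \<in> V))"
proof -
  have "limitin (RClop_topology n) f Q F \<longleftrightarrow> Q \<in> topspace (RClop_topology n) \<and>
      (\<forall>V\<in>{{Q \<in> RClop n. (map pr a \<in> Q) \<in> V} | a V. a \<in> tuples n}. Q \<in> V \<longrightarrow> (\<forall>\<^sub>F x in F. f x \<in> V))"
    by (simp only: RClop_topology_def limitin_topology_generated_by)
  then show ?thesis
    by (simp only: topspace_RClop_topology ball_Collect2) auto
qed

section \<open>Right continuous operations and right clopen relations\<close>

lemma RC_clopen:
  assumes "g \<in> RC n" "length as + 1 + length us = n"
  shows "open {u. \<forall>\<^sub>F x in Rep_beta (g (map pr as @ u # us)). P x}"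
    and "closed {u. \<forall>\<^sub>F x in Rep_beta (g (map pr as @ u # us)). P x}"
proof -
  have c: "continuous_on UNIV (\<lambda>u. g (map pr as @ u # us))"
    using assms by (simp add: RC_def)
  show "open {u. \<forall>\<^sub>F x in Rep_beta (g (map pr as @ u # us)). P x}"
    using open_vimage[OF open_beta_basic c] by (simp add: vimage_def)
  show "closed {u. \<forall>\<^sub>F x in Rep_beta (g (map pr as @ u # us)). P x}"
    using closed_vimage[OF closed_beta_basic c] by (simp add: vimage_def)
qed

lemma eventually_RC:
  assumes "g \<in> RC n" "length us = n"
  shows "(\<forall>\<^sub>F x in Rep_beta (g us). P x) \<longleftrightarrow>
    forall_ultra us (\<lambda>xs. \<forall>\<^sub>F x in Rep_beta (g (map pr xs)). P x)"
  by (rule forall_ultra_if_clopen_sections[OF _ assms(2)]) (simp add: RC_clopen[OF assms(1)])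

lemma mem_RClop_iff:
  assumes "Q \<in> RClop n" "length us = n"
  shows "us \<in> Q \<longleftrightarrow> forall_ultra us (\<lambda>xs. map pr xs \<in> Q)"
  using assms by (intro forall_ultra_if_clopen_sections) (auto simp: RClop_def)

text \<open>Behind a principal prefix the leading quantifiers are mere substitutions, so the
  quantifier over \<open>u\<close> becomes the outermost one. What remains is a basic open condition
  on \<open>u\<close>.\<close>

lemma app_ext_in_RC: "(\<lambda>us \<in> tuples n. app_ext us \<ff>) \<in> RC n"
  unfolding RC_def
proof (intro CollectI conjI allI impI)
  show "(\<lambda>us \<in> tuples n. app_ext us \<ff>) \<in> ops n" by (simp add: ops_def)
next
  fix as :: "'a list" and us :: "'a beta list"
  assume "length as + 1 + length us = n"
  then have "(\<lambda>us \<in> tuples n. app_ext us \<ff>) (map pr as @ u # us) = app_ext (map pr as @ u # us) \<ff>"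
    for u by (simp add: tuples_def)
  moreover have "continuous_on UNIV (\<lambda>u. app_ext (map pr as @ u # us) \<ff>)"
    by (rule continuous_on_UNIV_betaI)
      (simp add: eventually_app_ext forall_ultra_map_pr_append open_beta_basic)
  ultimately show "continuous_on UNIV (\<lambda>u. (\<lambda>us \<in> tuples n. app_ext us \<ff>) (map pr as @ u # us))"
    by (simp only:)
qed

lemma in_ext_in_RClop: "{us \<in> tuples n. in_ext us \<rr>} \<in> RClop n"
proof -
  have "{u. map pr as @ u # us \<in> {us \<in> tuples n. in_ext us \<rr>}} =
      {u. \<forall>\<^sub>F x in Rep_beta u. forall_ultra us (\<lambda>xs. \<forall>\<^sub>F Q in Rep_beta \<rr>. as @ x # xs \<in> Q)}"
    if "length as + 1 + length us = n" for as us
    using that by (simp add: tuples_def in_ext_def forall_ultra_map_pr_append)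
  then have "open {u. map pr as @ u # us \<in> {us \<in> tuples n. in_ext us \<rr>}} \<and>
      closed {u. map pr as @ u # us \<in> {us \<in> tuples n. in_ext us \<rr>}}"
    if "length as + 1 + length us = n" for as us
    using that by (simp only: open_beta_basic closed_beta_basic simp_thms)
  moreover have "{us \<in> tuples n. in_ext us \<rr>} \<in> rels n"
    by (auto simp: rels_def)
  ultimately show ?thesis
    unfolding RClop_def by blast
qed

text \<open>Quantifying over the principal ultrafilter at \<open>f\<close> amounts to inserting
  \<open>f\<close>, so the extension of a single operation is a special case of
  \<open>app_ext\<close>.\<close>

lemma ext_op_in_RC: "ext_op n f \<in> RC n"
  using app_ext_in_RC[where n = n and \<ff> = "pr f"] by (simp add: ext_op_def app_ext_def)

lemma ext_rel_in_RClop: "ext_rel n Q \<in> RClop n"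
  using in_ext_in_RClop[where n = n and \<rr> = "pr Q"] by (simp add: ext_rel_def in_ext_def)

lemma ext_op_map_pr: "a \<in> tuples n \<Longrightarrow> ext_op n f (map pr a) = pr (f a)"
  by (rule beta_eqI) (simp add: eventually_ext_op tuples_def)

lemma map_pr_mem_ext_rel: "a \<in> tuples n \<Longrightarrow> map pr a \<in> ext_rel n Q \<longleftrightarrow> a \<in> Q"
  by (simp add: ext_rel_def tuples_def)

section \<open>Limits of the interpreting ultrafilters\<close>

lemma has_limit_i_op:
  "has_limit (RC_topology n) (i_op n \<ff>) (\<lambda>us \<in> tuples n. app_ext us \<ff>)"
proof -
  let ?g = "\<lambda>us \<in> tuples n. app_ext us \<ff>"
  \<comment> \<open>Pulled back along \<open>ext_op n\<close>, convergence becomes a condition on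
    \<open>\<ff>\<close> alone, since every extension is right continuous and takes the value
    \<open>pr (f a)\<close> at the principal tuple of \<open>a\<close>.\<close>
  have lim_iff: "limitin (RC_topology n) (\<lambda>x. x) g (Rep_beta (i_op n \<ff>)) \<longleftrightarrow> g \<in> RC n \<and>
     (\<forall>a\<in>tuples n. \<forall>U. open U \<longrightarrow> g (map pr a) \<in> U \<longrightarrow> (\<forall>\<^sub>F f in Rep_beta \<ff>. pr (f a) \<in> U))"
    for g
    by (simp add: limitin_RC_topology eventually_i_op ext_op_in_RC ext_op_map_pr)
  have "limitin (RC_topology n) (\<lambda>x. x) ?g (Rep_beta (i_op n \<ff>))"
    unfolding lim_iff
  proof (intro conjI ballI allI impI)
    fix a U assume "a \<in> tuples n" "open U" "?g (map pr a) \<in> U"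
    \<comment> \<open>At a principal tuple \<open>app_ext\<close> is the image of
      \<open>\<ff>\<close> under evaluation at \<open>a\<close>, so being almost everywhere in a set
      for it means that \<open>f a\<close> is in that set for \<open>\<ff>\<close>-almost all
      \<open>f\<close>.\<close>
    then show "\<forall>\<^sub>F f in Rep_beta \<ff>. pr (f a) \<in> U"
      using open_beta_imp_eventually_pr[of U "app_ext (map pr a) \<ff>"]
      by (simp add: tuples_def eventually_app_ext)
  qed (rule app_ext_in_RC)
  moreover have "g = ?g" if "limitin (RC_topology n) (\<lambda>x. x) g (Rep_beta (i_op n \<ff>))" for g
  proof (rule ext)
    fix us
    from that have g: "g \<in> RC n" and lim: "\<And>a U. \<lbrakk>a \<in> tuples n; open U; g (map pr a) \<in> U\<rbrakk> \<Longrightarrow>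
        \<forall>\<^sub>F f in Rep_beta \<ff>. pr (f a) \<in> U"
      by (auto simp: lim_iff)
    \<comment> \<open>The neighbourhood used is the basic open set of \<open>P\<close>; it contains
      \<open>pr (f a)\<close> exactly when \<open>P (f a)\<close> holds. Applying this to the
      negation of \<open>P\<close> as well yields the equivalence below.\<close>
    have imp: "\<forall>\<^sub>F f in Rep_beta \<ff>. P (f a)"
      if "a \<in> tuples n" "\<forall>\<^sub>F x in Rep_beta (g (map pr a)). P x" for a P
      using lim[OF that(1) open_beta_basic] that(2) by simp
    have iff: "(\<forall>\<^sub>F x in Rep_beta (g (map pr a)). P x) \<longleftrightarrow> (\<forall>\<^sub>F f in Rep_beta \<ff>. P (f a))"
      if "a \<in> tuples n" for a P
      using imp[OF that, of P] imp[OF that, of "\<lambda>x. \<not> P x"]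
      by (auto simp: eventually_not_Rep_beta)
    show "g us = ?g us"
    proof (cases "us \<in> tuples n")
      case True
      then have "length us = n" by (simp add: tuples_def)
      then have "g us = app_ext us \<ff>"
        \<comment> \<open>Right continuity turns the left side into an iterated quantifier over
          principal tuples, where \<open>iff\<close> matches it with the one defining
          \<open>app_ext\<close>.\<close>
        by (intro beta_eqI, subst eventually_RC[OF g], simp, unfold eventually_app_ext)
          (auto intro!: forall_ultra_cong_length iff simp: tuples_def)
      with True show ?thesis by simp
    next
      case False
      \<comment> \<open>On lists of any other length both operations are \<open>undefined\<close>,
        by extensionality.\<close>
      with g show ?thesis by (auto simp: RC_def ops_def intro: PiE_arb)
    qed
  qed
  ultimately show ?thesis unfolding has_limit_def by blast
qed

lemma has_limit_i_rel:
  "has_limit (RClop_topology n) (i_rel n \<rr>) {us \<in> tuples n. in_ext us \<rr>}"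
proof -
  let ?Q = "{us \<in> tuples n. in_ext us \<rr>}"
  have lim_iff: "limitin (RClop_topology n) (\<lambda>x. x) Q (Rep_beta (i_rel n \<rr>)) \<longleftrightarrow> Q \<in> RClop n \<and>
     (\<forall>a\<in>tuples n. \<forall>V. (map pr a \<in> Q) \<in> V \<longrightarrow> (\<forall>\<^sub>F q in Rep_beta \<rr>. (a \<in> q) \<in> V))"
    for Q
    by (simp add: limitin_RClop_topology eventually_i_rel ext_rel_in_RClop map_pr_mem_ext_rel)
  have "limitin (RClop_topology n) (\<lambda>x. x) ?Q (Rep_beta (i_rel n \<rr>))"
    unfolding lim_iff
  proof (intro conjI ballI allI impI)
    fix a V assume "a \<in> tuples n" and V: "(map pr a \<in> ?Q) \<in> V"
    then have eq: "map pr a \<in> ?Q \<longleftrightarrow> (\<forall>\<^sub>F q in Rep_beta \<rr>. a \<in> q)"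
      by (simp add: tuples_def in_ext_def)
    \<comment> \<open>The truth value of \<open>a \<in> q\<close> is constant for
      \<open>\<rr>\<close>-almost all \<open>q\<close>, and \<open>?Q\<close> takes exactly this
      value at the principal tuple.\<close>
    have "\<forall>\<^sub>F q in Rep_beta \<rr>. (a \<in> q) = (map pr a \<in> ?Q)"
      unfolding eq
      by (cases "\<forall>\<^sub>F q in Rep_beta \<rr>. a \<in> q") (simp_all add: eventually_not_Rep_beta)
    then show "\<forall>\<^sub>F q in Rep_beta \<rr>. (a \<in> q) \<in> V"
      by (rule eventually_mono) (use V in \<open>simp only:\<close>)
  qed (rule in_ext_in_RClop)
  moreover have "Q = ?Q" if "limitin (RClop_topology n) (\<lambda>x. x) Q (Rep_beta (i_rel n \<rr>))" for Q
  proof -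
    from that have Q: "Q \<in> RClop n" and lim: "\<And>a V. \<lbrakk>a \<in> tuples n; (map pr a \<in> Q) \<in> V\<rbrakk> \<Longrightarrow>
        \<forall>\<^sub>F q in Rep_beta \<rr>. (a \<in> q) \<in> V"
      by (auto simp: lim_iff)
    have iff: "map pr a \<in> Q \<longleftrightarrow> (\<forall>\<^sub>F q in Rep_beta \<rr>. a \<in> q)" if "a \<in> tuples n" for a
      \<comment> \<open>By discreteness the singleton of the value of \<open>Q\<close> is a
        neighbourhood, so almost all \<open>q\<close> agree with \<open>Q\<close> there.\<close>
      using lim[OF that, of "{map pr a \<in> Q}"]
      by (cases "map pr a \<in> Q") (simp_all add: eventually_not_Rep_beta)
    have "us \<in> Q \<longleftrightarrow> in_ext us \<rr>" if "us \<in> tuples n" for us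
    proof -
      have "length us = n" using that by (simp add: tuples_def)
      then show ?thesis
        unfolding in_ext_def
        by (subst mem_RClop_iff[OF Q], simp)
          (auto intro!: forall_ultra_cong_length iff simp: tuples_def)
    qed
    moreover have "Q \<subseteq> tuples n" using Q by (simp add: RClop_def rels_def)
    ultimately show ?thesis by blast
  qed
  ultimately show ?thesis unfolding has_limit_def by blast
qed

section \<open>The limit model and satisfaction\<close>

lemma the_has_limit: "has_limit T u p \<Longrightarrow> (THE q. has_limit T u q) = p"
  by (rule the_equality) (auto simp: has_limit_def)

lemma lim_model_i_model:
  "lim_model RC_topology RClop_topology fa pa (i_model fa pa \<AA>) =
     \<lparr>op_of = (\<lambda>F. \<lambda>us \<in> tuples (fa F). app_ext us (gop_of \<AA> F)),
      rel_of = (\<lambda>R. {us \<in> tuples (pa R). in_ext us (grel_of \<AA> R)})\<rparr>"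
  by (simp add: lim_model_def i_model_def the_has_limit[OF has_limit_i_op]
      the_has_limit[OF has_limit_i_rel])

text \<open>Well-formedness keeps all argument lists at length \<open>fa F\<close>, where the limit
  operation agrees with \<open>app_ext\<close>; on other lists it is
  \<open>undefined\<close>.\<close>

lemma eval_lim_model:
  assumes "wf_tm fa t"
  shows "eval (lim_model RC_topology RClop_topology fa pa (i_model fa pa \<AA>)) v t = neval \<AA> v t"
  using assms
proof (induction t)
  case (Fn F ts)
  then have eq: "map (eval (lim_model RC_topology RClop_topology fa pa (i_model fa pa \<AA>)) v) ts =
      map (neval \<AA> v) ts"
    by simp
  from Fn.prems show ?case
    by (simp only: eval.simps neval.simps eq) (simp add: lim_model_i_model tuples_def)
qed simp

text \<open>Quantifiers range over all ultrafilters in both readings, so only atomic formulas need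
  an argument.\<close>

lemma sat_lim_model:
  assumes "wf_fm fa pa \<phi>"
  shows "sat (lim_model RC_topology RClop_topology fa pa (i_model fa pa \<AA>)) v \<phi> \<longleftrightarrow> nsat \<AA> v \<phi>"
  using assms
proof (induction \<phi> arbitrary: v)
  case (Rel R ts)
  then have eq: "map (eval (lim_model RC_topology RClop_topology fa pa (i_model fa pa \<AA>)) v) ts =
      map (neval \<AA> v) ts"
    by (simp add: eval_lim_model)
  from Rel show ?case
    by (simp only: sat.simps nsat.simps eq) (simp add: lim_model_i_model tuples_def)
qed (simp_all add: eval_lim_model)

theorem theorem35:
  fixes fa :: "'f \<Rightarrow> nat" and pa :: "'p \<Rightarrow> nat"
    and \<AA> :: "('f, 'p, 'a) gmodel" and \<UU> :: "('f, 'p, 'a beta) gmodel"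
  assumes "is_gmodel fa pa \<AA>"
    and "\<UU> = i_model fa pa \<AA>"
  shows "lim_exists RC_topology RClop_topology fa pa \<UU> \<and>
    (\<forall>(\<phi> :: ('f, 'p, 'v) fm) (v :: 'v \<Rightarrow> 'a beta). wf_fm fa pa \<phi> \<longrightarrow>
       (sat (lim_model RC_topology RClop_topology fa pa \<UU>) v \<phi> \<longleftrightarrow> nsat \<AA> v \<phi>))"
proof -
  have "lim_exists RC_topology RClop_topology fa pa \<UU>"
    using has_limit_i_op has_limit_i_rel by (fastforce simp: lim_exists_def i_model_def assms(2))
  then show ?thesis by (simp add: sat_lim_model assms(2))
qed

end
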